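(* Fix a real number $0<\delta\leq 1$. If $K$ is a $\delta$-Lipschitz filling of $C_n$, then $$|V(K)|\geq \frac{\delta^3}{8}(n-1)^2+\frac{1}{2}(n-1).$$
   Context: $C_n$ denotes the cycle graph on $n\ge 3$ vertices. An abstract triangulation is a simplicial complex $K$ of dimension $2$ such that every edge is contained in either $1$ or $2$ triangles. $V(K)$ denotes its set of vertices. The boundary $\partial K$ is the subcomplex induced by those edges contained in exactly one triangle (i.e. consisting of these edges and their endpoints). For $u,v\in V(K)$, $d_K(u,v)$ is the graph distance from $u$ to $v$ in the $1$-skeleton of $K$; for a graph $G$, $d_G$ is the graph distance in $G$. For a graph $G$ and $0<\delta\leq 1$, an abstract triangulation $K$ is a $\delta$-Lipschitz filling of $G$ if $\partial K=G$ and $d_K(x,y)\geq \delta\cdot d_G(x,y)$ for all $x,y\in V(G)$. *)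

theory Defs
  imports Complex_Main "HOL-Library.Extended_Nat" "HOL-Library.Extended_Real"
begin

record 'a graph =
  graph_verts :: "'a set"
  graph_edges :: "'a set set"

definition graph_iso :: "'a graph \<Rightarrow> 'b graph \<Rightarrow> bool" where
  "graph_iso G H \<longleftrightarrow>
     (\<exists>f. bij_betw f (graph_verts G) (graph_verts H) \<and>
          graph_edges H = (\<lambda>e. f ` e) ` graph_edges G)"

(* A simple graph only for n >= 3. *)
definition cycle_graph :: "nat \<Rightarrow> nat graph" where
  "cycle_graph n =
     \<lparr>graph_verts = {..<n}, graph_edges = {{i, Suc i mod n} | i. i < n}\<rparr>"

(* A walk is given by its list of vertices, so it has length p - 1 edges. *)
definition graph_walk :: "'a graph \<Rightarrow> 'a \<Rightarrow> 'a list \<Rightarrow> 'a \<Rightarrow> bool" where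
  "graph_walk G u p v \<longleftrightarrow>
     p \<noteq> [] \<and> hd p = u \<and> last p = v \<and> set p \<subseteq> graph_verts G \<and>
     successively (\<lambda>x y. {x, y} \<in> graph_edges G) p"

(* The distance is infinite if no walk joins u and v: the infimum of the empty set is \<infinity>. *)
definition graph_dist :: "'a graph \<Rightarrow> 'a \<Rightarrow> 'a \<Rightarrow> enat" where
  "graph_dist G u v = (INF p\<in>{p. graph_walk G u p v}. enat (length p - 1))"

(* The empty simplex is excluded; K need not be finite. *)
definition abstract_simplicial_complex :: "'a set set \<Rightarrow> bool" where
  "abstract_simplicial_complex K \<longleftrightarrow>
     (\<forall>s\<in>K. finite s \<and> s \<noteq> {}) \<and>
     (\<forall>s\<in>K. \<forall>t. t \<noteq> {} \<and> t \<subseteq> s \<longrightarrow> t \<in> K)"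

definition has_dimension :: "'a set set \<Rightarrow> nat \<Rightarrow> bool" where
  "has_dimension K d \<longleftrightarrow> (\<forall>s\<in>K. card s \<le> d + 1) \<and> (\<exists>s\<in>K. card s = d + 1)"

definition complex_verts :: "'a set set \<Rightarrow> 'a set" where
  "complex_verts K = {v. {v} \<in> K}"

definition complex_edges :: "'a set set \<Rightarrow> 'a set set" where
  "complex_edges K = {s \<in> K. card s = 2}"

definition complex_triangles :: "'a set set \<Rightarrow> 'a set set" where
  "complex_triangles K = {s \<in> K. card s = 3}"

definition triangles_at :: "'a set set \<Rightarrow> 'a set \<Rightarrow> 'a set set" where
  "triangles_at K e = {t \<in> complex_triangles K. e \<subseteq> t}"

(* An edge in infinitely many triangles is excluded as well, since card is then 0. *)
definition abstract_triangulation :: "'a set set \<Rightarrow> bool" where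
  "abstract_triangulation K \<longleftrightarrow>
     abstract_simplicial_complex K \<and> has_dimension K 2 \<and>
     (\<forall>e\<in>complex_edges K. card (triangles_at K e) = 1 \<or> card (triangles_at K e) = 2)"

definition one_skeleton :: "'a set set \<Rightarrow> 'a graph" where
  "one_skeleton K = \<lparr>graph_verts = complex_verts K, graph_edges = complex_edges K\<rparr>"

(* The boundary has dimension at most 1 and is represented as a graph. *)
definition boundary :: "'a set set \<Rightarrow> 'a graph" where
  "boundary K =
     (let B = {e \<in> complex_edges K. card (triangles_at K e) = 1}
      in \<lparr>graph_verts = \<Union>B, graph_edges = B\<rparr>)"

definition lipschitz_filling :: "real \<Rightarrow> 'a graph \<Rightarrow> 'a set set \<Rightarrow> bool" where
  "lipschitz_filling \<delta> G K \<longleftrightarrow>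
     abstract_triangulation K \<and> boundary K = G \<and>
     (\<forall>x\<in>graph_verts G. \<forall>y\<in>graph_verts G.
        ereal_of_enat (graph_dist (one_skeleton K) x y)
          \<ge> ereal \<delta> * ereal_of_enat (graph_dist G x y))"

end

theory Submission imports Defs begin

text \<open>
  Let f be the distance in K from a boundary vertex c 0, and let c m be the opposite boundary
  vertex. By a parity argument every level set of f at height r with 0 < r < f (c m) contains a walk
  joining the two arcs of the cycle between c 0 and c m. Its ends have cycle distance between r and
  r / \<delta> from c 0, so they are at distance at least min (2 \<delta> r) (\<delta> n - 2 r) in K, and a shortest such
  walk has almost that many vertices off the boundary. Summing over r and adding the n boundary
  vertices gives the bound.
\<close>

section \<open>Walks and graph distance\<close>

lemma graph_walk_append_iff:
  "graph_walk G u (p @ v # q) w \<longleftrightarrow> graph_walk G u (p @ [v]) v \<and> graph_walk G v (v # q) w"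
proof -
  have "successively P (p @ v # q) \<longleftrightarrow> successively P (p @ [v]) \<and> successively P (v # q)" for P
    by (auto simp: successively_append_iff)
  then show ?thesis unfolding graph_walk_def by (cases p) auto
qed

lemma graph_dist_le_walk: "graph_walk G u p v \<Longrightarrow> graph_dist G u v \<le> enat (length p - 1)"
  unfolding graph_dist_def by (rule INF_lower) simp

lemma graph_dist_self: "u \<in> graph_verts G \<Longrightarrow> graph_dist G u u = 0"
  using graph_dist_le_walk[of G u "[u]" u] by (simp add: graph_walk_def flip: zero_enat_def)

lemma graph_dist_edge_le:
  assumes "{v, w} \<in> graph_edges G" "w \<in> graph_verts G"
  shows "graph_dist G u w \<le> graph_dist G u v + 1"
proof (cases "graph_dist G u v")
  case (enat k)
  have ne: "{p. graph_walk G u p v} \<noteq> {}"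
  proof
    assume "{p. graph_walk G u p v} = {}"
    then have "graph_dist G u v = \<infinity>" by (simp add: graph_dist_def top_enat_def)
    then show False using enat by simp
  qed
  \<comment> \<open>Since \<open>enat\<close> is well-ordered, the infimum of a nonempty set is
    attained, here by a shortest walk.\<close>
  then have "graph_dist G u v \<in> (\<lambda>p. enat (length p - 1)) ` {p. graph_walk G u p v}"
    unfolding graph_dist_def by (metis (no_types, lifting) ex_in_conv image_is_empty wellorder_InfI)
  then obtain p where p: "graph_walk G u p v" and k: "graph_dist G u v = enat (length p - 1)"
    by blast
  have "graph_walk G u (p @ [w]) w"
    using p assms by (auto simp: graph_walk_def successively_append_iff)
  from graph_dist_le_walk[OF this] show ?thesis
    using p by (simp add: k one_enat_def graph_walk_def)
qed simp

text \<open>Along each edge of a walk \<open>h\<close> grows by at most 1, so a walk on which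
  \<open>h\<close> rises from 0 to \<open>h v\<close> has at least \<open>h v\<close> edges. This
  turns a lower bound on distance into the choice of a potential.\<close>

lemma graph_dist_ge_potential:
  fixes h :: "'a \<Rightarrow> nat"
  assumes "\<And>v w. {v, w} \<in> graph_edges G \<Longrightarrow> h w \<le> h v + 1" and "h u = 0"
  shows "enat (h v) \<le> graph_dist G u v"
proof -
  have "h (last p) \<le> h (hd p) + (length p - 1)"
    if "p \<noteq> []" "successively (\<lambda>x y. {x, y} \<in> graph_edges G) p" for p
    using that
  proof (induction p rule: induct_list012)
    case (3 x y zs)
    then show ?case using assms(1)[of x y] by simp
  qed auto
  then show ?thesis
    using assms(2) unfolding graph_dist_def by (intro INF_greatest) (fastforce simp: graph_walk_def)
qed

text \<open>Take a walk that is shortest among all walks from \<open>X\<close> to \<open>Y\<close>,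
  not just between \<open>x0\<close> and \<open>y0\<close>. It repeats no vertex and meets
  \<open>X\<close> and \<open>Y\<close> only at its ends, so its inner vertices are distinct
  vertices outside \<open>X \<union> Y\<close>; it has one edge more than inner vertices.\<close>

lemma graph_dist_le_card_interior:
  assumes "x0 \<in> X" "y0 \<in> Y" "graph_walk H x0 p0 y0" "X \<inter> Y = {}" "finite (graph_verts H)"
  obtains x y where "x \<in> X" "y \<in> Y" "x \<in> graph_verts H" "y \<in> graph_verts H"
    "graph_dist H x y \<le> enat (card (graph_verts H - (X \<union> Y)) + 1)"
proof -
  define P where "P p \<longleftrightarrow> (\<exists>x\<in>X. \<exists>y\<in>Y. graph_walk H x p y)" for p
  define p where "p = arg_min length P"
  have "P p0" using assms P_def by blast
  then have "P p" and minimal: "\<And>q. P q \<Longrightarrow> length p \<le> length q"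
    unfolding p_def by (auto intro: arg_min_natI arg_min_nat_le)
  then obtain x y where xy: "x \<in> X" "y \<in> Y" and walk: "graph_walk H x p y"
    using P_def by blast
  have "x \<noteq> y" using xy assms by blast
  then obtain q where p: "p = x # q @ [y]"
    using walk unfolding graph_walk_def
    by (metis append_Nil append_butlast_last_id last_ConsL list.collapse last.simps)
  have "distinct p"
  \<comment> \<open>Cutting out the loop between two occurrences of \<open>z\<close> would leave a
    shorter walk.\<close>
  proof (rule ccontr)
    assume "\<not> distinct p"
    then obtain a z b d where "p = a @ [z] @ b @ [z] @ d"
      using not_distinct_decomp by blast
    then have eq: "p = a @ z # (b @ z # d)" "p = (a @ z # b) @ z # d"
      by simp_all
    have "graph_walk H x (a @ [z]) z"
      using walk eq(1) graph_walk_append_iff[of H x a z "b @ z # d" y] by metis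
    moreover have "graph_walk H z (z # d) y"
      using walk eq(2) graph_walk_append_iff[of H x "a @ z # b" z d y] by metis
    ultimately have "P (a @ z # d)"
      using xy P_def graph_walk_append_iff[of H x a z d y] by blast
    from minimal[OF this] show False by (simp add: eq)
  qed
  moreover have "z \<notin> X \<union> Y" if z: "z \<in> set q" for z
  proof -
    obtain a b where q: "q = a @ z # b" using split_list[OF z] by blast
    have "graph_walk H x (x # a @ [z]) z" "graph_walk H z (z # b @ [y]) y"
      using walk graph_walk_append_iff[of H x "x # a" z "b @ [y]" y] by (simp_all add: p q)
    \<comment> \<open>An inner vertex in \<open>Y\<close> would let the walk stop early, and one in
      \<open>X\<close> would let it start late.\<close>
    moreover have "\<not> P (x # a @ [z])" "\<not> P (z # b @ [y])"
      using minimal[of "x # a @ [z]"] minimal[of "z # b @ [y]"] by (auto simp: p q)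
    ultimately show ?thesis using xy P_def by blast
  qed
  moreover have "set p \<subseteq> graph_verts H" using walk by (simp add: graph_walk_def)
  ultimately have "set q \<subseteq> graph_verts H - (X \<union> Y)" "distinct q" by (auto simp: p)
  then have "length q \<le> card (graph_verts H - (X \<union> Y))"
    using assms(5) by (metis card_mono distinct_card finite_Diff)
  moreover have "graph_dist H x y \<le> enat (length q + 1)"
    using graph_dist_le_walk[OF walk] by (simp add: p)
  ultimately have "graph_dist H x y \<le> enat (card (graph_verts H - (X \<union> Y)) + 1)"
    by (meson add_le_mono1 enat_ord_simps(1) order_trans)
  with that xy \<open>set p \<subseteq> graph_verts H\<close> show ?thesis by (simp add: p)
qed

lemma graph_dist_antimono:
  assumes "graph_verts H \<subseteq> graph_verts G" "graph_edges H \<subseteq> graph_edges G"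
  shows "graph_dist G u v \<le> graph_dist H u v"
  unfolding graph_dist_def
proof (rule INF_superset_mono)
  show "{p. graph_walk H u p v} \<subseteq> {p. graph_walk G u p v}"
    using assms unfolding graph_walk_def by (auto elim!: successively_mono)
qed simp

section \<open>Parity and level sets\<close>

text \<open>
  Every triangle contains an even number of edges joining A to U, and modulo 2 the sum of these
  numbers over all triangles counts only the boundary edges.
\<close>
lemma even_card_bichromatic_boundary_edges:
  assumes K: "abstract_triangulation K" "finite K" and disj: "A \<inter> U = {}"
    and tri: "\<And>t. t \<in> complex_triangles K \<Longrightarrow> t \<inter> A \<noteq> {} \<Longrightarrow> t \<inter> U \<noteq> {} \<Longrightarrow> t \<subseteq> A \<union> U"
  shows "even (card {e \<in> graph_edges (boundary K). e \<inter> A \<noteq> {} \<and> e \<inter> U \<noteq> {}})"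
proof -
  define E where "E = {e \<in> complex_edges K. e \<inter> A \<noteq> {} \<and> e \<inter> U \<noteq> {}}"
  define T where "T = complex_triangles K"
  have fin: "finite E" "finite T"
    using K(2) by (auto simp: E_def T_def complex_edges_def complex_triangles_def)
  have closed: "s \<in> K" if "t \<in> K" "s \<subseteq> t" "s \<noteq> {}" for s t
    using K(1) that unfolding abstract_triangulation_def abstract_simplicial_complex_def by blast
  have even_in_triangle: "even (card {e \<in> E. e \<subseteq> t})" if t: "t \<in> T" for t
  proof -
    have tK: "t \<in> K" and card_t: "card t = 3"
      using t by (auto simp: T_def complex_triangles_def)
    then have "finite t" by (metis card.infinite zero_neq_numeral)
    let ?pair = "\<lambda>(a, u). {a, u}"
    have "{e \<in> E. e \<subseteq> t} = ?pair ` ((t \<inter> A) \<times> (t \<inter> U))"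
    proof (intro equalityI subsetI)
      fix e assume e: "e \<in> {e \<in> E. e \<subseteq> t}"
      then obtain a u where au: "a \<in> e" "a \<in> A" "u \<in> e" "u \<in> U" by (auto simp: E_def)
      have "card e = 2" using e by (auto simp: E_def complex_edges_def)
      moreover have "a \<noteq> u" using au disj by blast
      ultimately have "e = {a, u}" using au by (auto simp: card_2_iff)
      then show "e \<in> ?pair ` ((t \<inter> A) \<times> (t \<inter> U))" using e au by auto
    next
      fix e assume "e \<in> ?pair ` ((t \<inter> A) \<times> (t \<inter> U))"
      then obtain a u where e: "e = {a, u}" "a \<in> t" "a \<in> A" "u \<in> t" "u \<in> U" by auto
      then have "a \<noteq> u" using disj by blast
      then show "e \<in> {e \<in> E. e \<subseteq> t}"
        using e closed[OF tK, of e] by (auto simp: E_def complex_edges_def)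
    qed
    moreover have "inj_on ?pair ((t \<inter> A) \<times> (t \<inter> U))"
      using disj by (auto simp: inj_on_def doubleton_eq_iff)
    ultimately have card_eq: "card {e \<in> E. e \<subseteq> t} = card (t \<inter> A) * card (t \<inter> U)"
      by (simp add: card_image card_cartesian_product)
    show ?thesis
    proof (cases "t \<inter> A = {} \<or> t \<inter> U = {}")
      case True
      then show ?thesis unfolding card_eq by auto
    next
      case False
      then have "t = (t \<inter> A) \<union> (t \<inter> U)" using tri t T_def by blast
      \<comment> \<open>Of two numbers with odd sum one is even, and hence so is their
        product.\<close>
      then have "card (t \<inter> A) + card (t \<inter> U) = 3"
        using card_t \<open>finite t\<close> disj
        by (metis card_Un_disjoint finite_Int inf_assoc inf_bot_right inf_commute inf_left_commute)
      then show ?thesis unfolding card_eq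
        by (metis even_add even_mult_iff odd_numeral)
    qed
  qed
  \<comment> \<open>Double counting of the pairs of an edge in \<open>E\<close> and a triangle
    containing it. Modulo 2 only edges in exactly one triangle survive, and these form the
    boundary.\<close>
  have "(\<Sum>e\<in>E. card (triangles_at K e)) = (\<Sum>t\<in>T. card {e \<in> E. e \<subseteq> t})"
    using sum_multicount_gen[of E T "\<lambda>e t. e \<subseteq> t" "\<lambda>t. card {e \<in> E. e \<subseteq> t}"] fin
    by (simp add: triangles_at_def T_def)
  then have "even (\<Sum>e\<in>E. card (triangles_at K e))"
    using even_in_triangle by (simp add: dvd_sum)
  then have "even (card {e \<in> E. odd (card (triangles_at K e))})"
    using fin(1) by (simp add: even_sum_iff)
  moreover have "{e \<in> E. odd (card (triangles_at K e))} =
      {e \<in> graph_edges (boundary K). e \<inter> A \<noteq> {} \<and> e \<inter> U \<noteq> {}}"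
    using K(1) by (auto simp: E_def boundary_def Let_def abstract_triangulation_def)
  ultimately show ?thesis by simp
qed

lemma odd_card_switches:
  assumes "P 0" "\<not> P m"
  shows "odd (card {i::nat. i < m \<and> P i \<noteq> P (Suc i)})"
proof -
  \<comment> \<open>The right endpoint is left free for the induction: adding an index changes both
    sides exactly when it is a switch.\<close>
  have "odd (card {i. i < m \<and> P i \<noteq> P (Suc i)}) \<longleftrightarrow> P 0 \<noteq> P m" for m
  proof (induction m)
    case (Suc m)
    have "{i. i < Suc m \<and> P i \<noteq> P (Suc i)} = {i. i < m \<and> P i \<noteq> P (Suc i)} \<union>
        (if P m \<noteq> P (Suc m) then {m} else {})"
      by (auto simp: less_Suc_eq)
    then show ?case using Suc by auto
  qed simp
  with assms show ?thesis by blast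
qed

text \<open>
  Let A be the set below the level and U the part of the level set reachable from the arc from
  c 0 to c m. If U missed the other arc, the boundary edges joining A to U would be exactly the
  switches into or out of A along the first arc: an odd number, since c 0 lies in A and c m does not.
\<close>
lemma level_set_joins_arcs:
  fixes f :: "'a \<Rightarrow> enat" and c :: "nat \<Rightarrow> 'a" and K :: "'a set set" and r :: nat
  defines "H \<equiv> \<lparr>graph_verts = {v \<in> complex_verts K. f v = enat r}, graph_edges = complex_edges K\<rparr>"
  assumes K: "abstract_triangulation K" "finite K"
    and bd: "graph_edges (boundary K) = (\<lambda>i. {c i, c (Suc i mod n)}) ` {..<n}"
    and c: "inj_on c {..<n}" "c ` {..<n} \<subseteq> complex_verts K" and m: "m < n"
    and lip: "\<And>u v. {u, v} \<in> complex_edges K \<Longrightarrow> f v \<le> f u + 1"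
    and r: "f (c 0) < enat r" "enat r < f (c m)"
  obtains i j p where "0 < i" "i < m" "m < j" "j < n" "graph_walk H (c i) p (c j)"
proof (rule ccontr)
  note found = that
  assume "\<not> thesis"
  then have none: False if "0 < i" "i < m" "m < j" "j < n" "graph_walk H (c i) p (c j)" for i j p
    using found that by blast
  define A where "A = {v. f v < enat r}"
  define U where "U = {v. \<exists>i p. 0 < i \<and> i < m \<and> graph_walk H (c i) p v}"
  have U_level: "v \<in> complex_verts K \<and> f v = enat r" if "v \<in> U" for v
    using that last_in_set unfolding U_def graph_walk_def H_def by fastforce
  have U_step: "w \<in> U" if "v \<in> U" "{v, w} \<in> complex_edges K" "w \<in> complex_verts K" "f w = enat r"
    for v w
  proof -
    obtain i p where i: "0 < i" "i < m" and p: "graph_walk H (c i) p v"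
      using \<open>v \<in> U\<close> U_def by blast
    have "graph_walk H (c i) (p @ [w]) w"
      using p that by (auto simp: graph_walk_def successively_append_iff H_def)
    then show ?thesis using i U_def by blast
  qed
  have A_step: "f w \<le> enat r" if "v \<in> A" "{v, w} \<in> complex_edges K" for v w
  proof -
    have "f w \<le> f v + 1" using lip that(2) .
    also have "f v + 1 \<le> enat r" using that(1) A_def by (simp add: ileI1 flip: eSuc_plus_1)
    finally show ?thesis .
  qed
  have closed: "s \<in> K" if "t \<in> K" "s \<subseteq> t" "s \<noteq> {}" for s t
    using K(1) that unfolding abstract_triangulation_def abstract_simplicial_complex_def by blast
  have edge: "{v, w} \<in> complex_edges K" if "t \<in> complex_triangles K" "v \<in> t" "w \<in> t" "v \<noteq> w" for t v w
    using that closed[of t "{v, w}"] by (auto simp: complex_edges_def complex_triangles_def)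
  have "A \<inter> U = {}" using U_level by (auto simp: A_def)
  \<comment> \<open>A vertex of \<open>t\<close> outside \<open>A\<close> is adjacent to one in
    \<open>A\<close>, so its level is exactly \<open>r\<close>; being adjacent to a vertex of
    \<open>U\<close> as well, it is reached by extending a walk.\<close>
  have triangle: "t \<subseteq> A \<union> U" if t: "t \<in> complex_triangles K" and "t \<inter> A \<noteq> {}" "t \<inter> U \<noteq> {}" for t
  proof
    fix w assume w: "w \<in> t"
    obtain a u where au: "a \<in> t" "a \<in> A" "u \<in> t" "u \<in> U" using \<open>t \<inter> A \<noteq> {}\<close> \<open>t \<inter> U \<noteq> {}\<close> by blast
    show "w \<in> A \<union> U"
    proof (rule ccontr)
      assume w': "w \<notin> A \<union> U"
      have "f w \<le> enat r" using A_step[of a w] edge[OF t] au w w' by blast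
      then have "f w = enat r" using w' by (auto simp: A_def)
      moreover have "w \<in> complex_verts K"
        using t w closed[of t "{w}"] by (auto simp: complex_triangles_def complex_verts_def)
      ultimately have "w \<in> U" using U_step[of u w] edge[OF t] au w w' by blast
      then show False using w' by blast
    qed
  qed
  \<comment> \<open>Beyond \<open>m\<close>, membership in \<open>U\<close> would give the excluded
    walk; \<open>c m\<close> itself lies above level \<open>r\<close>.\<close>
  have in_U: "c i \<in> U \<longleftrightarrow> i < m \<and> f (c i) = enat r" if "i < n" for i
  proof
    assume "c i \<in> U"
    then have "f (c i) = enat r" using U_level by blast
    moreover have "\<not> m < i" using \<open>c i \<in> U\<close> none that unfolding U_def by blast
    moreover have "i \<noteq> m" using r \<open>f (c i) = enat r\<close> by auto
    ultimately show "i < m \<and> f (c i) = enat r" by simp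
  next
    assume i: "i < m \<and> f (c i) = enat r"
    then have "graph_walk H (c i) [c i] (c i)" "0 < i"
      using c(2) that r by (auto simp: graph_walk_def H_def intro!: Nat.gr0I)
    then show "c i \<in> U" using i U_def by blast
  qed
  let ?S = "{i. i < m \<and> (c i \<in> A) \<noteq> (c (Suc i) \<in> A)}"
  let ?edge = "\<lambda>i. {c i, c (Suc i)}"
  have bd_edge: "{c i, c (Suc i mod n)} \<in> complex_edges K" if "i < n" for i
    using that bd by (fastforce simp: boundary_def Let_def)
  have "{e \<in> graph_edges (boundary K). e \<inter> A \<noteq> {} \<and> e \<inter> U \<noteq> {}} = ?edge ` ?S"
  proof (intro equalityI subsetI)
    fix e assume "e \<in> {e \<in> graph_edges (boundary K). e \<inter> A \<noteq> {} \<and> e \<inter> U \<noteq> {}}"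
    then obtain i where i: "i < n" "e = {c i, c (Suc i mod n)}" and e: "e \<inter> A \<noteq> {}" "e \<inter> U \<noteq> {}"
      using bd by auto
    \<comment> \<open>Otherwise the end in \<open>U\<close> is the second one, with index below
      \<open>m\<close>. This happens only on the edge closing the cycle, whose second end
      \<open>c 0\<close> lies below level \<open>r\<close>.\<close>
    have "i < m"
    proof (rule ccontr)
      assume "\<not> i < m"
      then have "c i \<notin> U" using in_U i by blast
      then have *: "c (Suc i mod n) \<in> U" using e i by blast
      then have "Suc i mod n < m" using in_U[of "Suc i mod n"] i by auto
      then have "Suc i mod n = 0" using \<open>\<not> i < m\<close> i(1) by (cases "Suc i = n") auto
      then show False using * U_level r(1) by force
    qed
    then have "e = ?edge i" using i m by auto
    then show "e \<in> ?edge ` ?S" using \<open>i < m\<close> e \<open>A \<inter> U = {}\<close> by auto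
  next
    fix e assume "e \<in> ?edge ` ?S"
    then obtain i where i: "i < m" "e = ?edge i" "(c i \<in> A) \<noteq> (c (Suc i) \<in> A)" by auto
    have mod: "Suc i mod n = Suc i" "i < n" "Suc i < n" using i m by auto
    then have E: "?edge i \<in> complex_edges K" using bd_edge[of i] by simp
    \<comment> \<open>Levels change by at most 1 along an edge, so the end of a switch outside
      \<open>A\<close> has level exactly \<open>r\<close>. It is not \<open>c m\<close>, hence has
      index below \<open>m\<close> and lies in \<open>U\<close> by \<open>in_U\<close>.\<close>
    have "Suc i \<noteq> m" if "c i \<in> A"
      using A_step[OF that E] r(2) by auto
    moreover have "f (c i) = enat r" if "c (Suc i) \<in> A" "c i \<notin> A"
      using A_step[OF that(1), of "c i"] E that(2) by (simp add: insert_commute A_def)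
    moreover have "f (c (Suc i)) = enat r" if "c i \<in> A" "c (Suc i) \<notin> A"
      using A_step[OF that(1) E] that(2) by (simp add: A_def)
    ultimately have "e \<inter> A \<noteq> {} \<and> e \<inter> U \<noteq> {}"
      using i mod in_U[of i] in_U[of "Suc i"] by (cases "c i \<in> A") auto
    moreover have "e \<in> graph_edges (boundary K)" using i mod unfolding bd by (intro image_eqI[of _ _ i]) simp_all
    ultimately show "e \<in> {e \<in> graph_edges (boundary K). e \<inter> A \<noteq> {} \<and> e \<inter> U \<noteq> {}}" by blast
  qed
  moreover have "inj_on ?edge ?S"
  proof (rule inj_onI)
    fix i j assume ij: "i \<in> ?S" "j \<in> ?S" "?edge i = ?edge j"
    then have "i < n" "j < n" "Suc i < n" "Suc j < n" using m by auto
    with ij(3) c(1) show "i = j" by (fastforce simp: doubleton_eq_iff inj_on_eq_iff)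
  qed
  ultimately have "card {e \<in> graph_edges (boundary K). e \<inter> A \<noteq> {} \<and> e \<inter> U \<noteq> {}} = card ?S"
    by (simp add: card_image)
  moreover have "odd (card ?S)"
    using odd_card_switches[of "\<lambda>i. c i \<in> A" m] r by (simp add: A_def)
  moreover have "even (card {e \<in> graph_edges (boundary K). e \<inter> A \<noteq> {} \<and> e \<inter> U \<noteq> {}})"
    by (rule even_card_bichromatic_boundary_edges[OF K \<open>A \<inter> U = {}\<close> triangle])
  ultimately show False by simp
qed

section \<open>The tent sum and distance on the cycle\<close>

text \<open>The tent over the interval from 0 to \<open>D\<close> has area
  \<open>D\<^sup>2 / 4\<close>; the loss of \<open>1 / 4\<close> covers the rounding at its peak and
  at its right end.\<close>

lemma sum_tent_ge:
  fixes D :: real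
  assumes "0 < D" "real T < D" "D \<le> real T + 1"
  shows "(\<Sum>r=1..T. min (real r) (D - real r)) \<ge> (D\<^sup>2 - 1) / 4"
proof -
  \<comment> \<open>\<open>k\<close> is the last integer on the rising side of the tent.\<close>
  define k where "k = nat \<lfloor>D / 2\<rfloor>"
  have k: "real k \<le> D / 2" "D / 2 < real k + 1" using assms(1) unfolding k_def by linarith+
  have "k \<le> T" using k assms by linarith
  have S: "(\<Sum>r=1..N. real r) = real N * (real N + 1) / 2" for N
    by (induction N) (auto simp: field_simps)
  have "(\<Sum>r=1..T. min (real r) (D - real r)) =
      (\<Sum>r=1..T. D - real r) - (\<Sum>r=1..k. D - real r) + (\<Sum>r=1..k. real r)"
  proof -
    have "{1..T} = {1..k} \<union> {Suc k..T}" using \<open>k \<le> T\<close> by auto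
    then have split: "(\<Sum>r=1..T. g r) = (\<Sum>r=1..k. g r) + (\<Sum>r=Suc k..T. g r)" for g :: "nat \<Rightarrow> real"
      by (simp add: sum.union_disjoint)
    have "(\<Sum>r=1..k. min (real r) (D - real r)) = (\<Sum>r=1..k. real r)"
      using k(1) by (intro sum.cong) (auto simp: min_def)
    moreover have "(\<Sum>r=Suc k..T. min (real r) (D - real r)) = (\<Sum>r=Suc k..T. D - real r)"
      using k(2) by (intro sum.cong) (auto simp: min_def)
    ultimately show ?thesis unfolding split[of "\<lambda>r. min (real r) (D - real r)"]
        split[of "\<lambda>r. D - real r"] by simp
  qed
  also have "\<dots> = (real T - real k) * D - real T * (real T + 1) / 2 + real k * (real k + 1)"
    by (simp add: sum_subtractf S[unfolded One_nat_def] algebra_simps)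
  also have "\<dots> \<ge> (D\<^sup>2 - 1) / 4"
  proof -
    \<comment> \<open>In terms of the rounding errors \<open>t\<close> at the right end and
      \<open>s\<close> at the peak, the surplus is a sum of two nonnegative terms.\<close>
    define t where "t = D - real T"
    define s where "s = D / 2 - real k"
    have "t * (1 - t) \<ge> 0" using assms by (simp add: t_def)
    moreover have "(s - 1 / 2)\<^sup>2 \<ge> 0" by simp
    moreover have "(real T - real k) * D - real T * (real T + 1) / 2 + real k * (real k + 1)
        - (D\<^sup>2 - 1) / 4 = t * (1 - t) / 2 + (s - 1 / 2)\<^sup>2"
      unfolding t_def s_def by (simp add: power2_eq_square field_simps)
    ultimately show ?thesis by linarith
  qed
  finally show ?thesis .
qed

text \<open>The cyclic distance of an index from \<open>i\<close> serves as the potential; it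
  changes by at most 1 along every edge, including the one closing the cycle.\<close>

lemma cycle_dist_ge:
  fixes c :: "nat \<Rightarrow> 'a"
  assumes c: "inj_on c {..<n}"
    and E: "graph_edges G = (\<lambda>i. {c i, c (Suc i mod n)}) ` {..<n}"
    and "i \<le> j" "j < n"
  shows "enat (min (j - i) (n - (j - i))) \<le> graph_dist G (c i) (c j)"
proof -
  define d where "d a = nat \<bar>int a - int i\<bar>" for a
  define h where "h v = (let a = inv_into {..<n} c v in min (d a) (n - d a))" for v
  have h: "h (c a) = min (d a) (n - d a)" if "a < n" for a
    using that c by (simp add: h_def)
  have step: "h (c (Suc a mod n)) \<le> h (c a) + 1 \<and> h (c a) \<le> h (c (Suc a mod n)) + 1"
    if "a < n" for a
  proof (cases "Suc a = n")
    case True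
    then show ?thesis using \<open>i \<le> j\<close> \<open>j < n\<close> by (auto simp: h d_def)
  next
    case False
    then have "h (c (Suc a mod n)) = min (d (Suc a)) (n - d (Suc a))" "h (c a) = min (d a) (n - d a)"
      using that by (simp_all add: h)
    moreover have "d (Suc a) \<le> d a + 1" "d a \<le> d (Suc a) + 1" by (auto simp: d_def)
    ultimately show ?thesis by auto
  qed
  have "enat (h (c j)) \<le> graph_dist G (c i) (c j)"
  proof (rule graph_dist_ge_potential)
    fix v w assume "{v, w} \<in> graph_edges G"
    then obtain a where "a < n" "{v, w} = {c a, c (Suc a mod n)}" using E by auto
    then show "h w \<le> h v + 1" using step[of a] by (auto simp: doubleton_eq_iff)
  next
    show "h (c i) = 0" using assms by (simp add: h d_def)
  qed
  then show ?thesis using assms by (simp add: h d_def nat_diff_distrib)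
qed

section \<open>Counting vertices level by level\<close>

theorem theorem2p1:
  fixes \<delta> :: real and n :: nat and G :: "'a graph" and K :: "'a set set"
  assumes "0 < \<delta>" and "\<delta> \<le> 1" and "n \<ge> 3"
    and "graph_iso (cycle_graph n) G"
    and "lipschitz_filling \<delta> G K"
  shows "infinite (complex_verts K) \<or>
         real (card (complex_verts K))
           \<ge> \<delta> ^ 3 / 8 * (real n - 1) ^ 2 + 1 / 2 * (real n - 1)"
proof (unfold disj_imp, rule impI)
  assume "\<not> infinite (complex_verts K)"
  then have fin: "finite (complex_verts K)" by simp
  have K: "abstract_triangulation K" and bd: "boundary K = G"
    and lipschitz: "\<And>x y. x \<in> graph_verts G \<Longrightarrow> y \<in> graph_verts G \<Longrightarrow>
      ereal \<delta> * ereal_of_enat (graph_dist G x y) \<le> ereal_of_enat (graph_dist (one_skeleton K) x y)"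
    using assms(5) unfolding lipschitz_filling_def by auto
  have closed: "s \<in> K" if "t \<in> K" "s \<subseteq> t" "s \<noteq> {}" for s t
    using K that unfolding abstract_triangulation_def abstract_simplicial_complex_def by blast
  have "K \<subseteq> Pow (complex_verts K)"
    using closed by (fastforce simp: complex_verts_def)
  then have finK: "finite K" using fin by (meson finite_Pow_iff finite_subset)
  obtain c where c: "bij_betw c {..<n} (graph_verts G)"
    and "graph_edges G = (\<lambda>e. c ` e) ` {{i, Suc i mod n} |i. i < n}"
    using assms(4) unfolding graph_iso_def cycle_graph_def by auto
  then have E: "graph_edges G = (\<lambda>i. {c i, c (Suc i mod n)}) ` {..<n}"
    by (auto simp: image_iff) (metis image_empty image_insert)+
  have inj: "inj_on c {..<n}" and verts: "graph_verts G = c ` {..<n}"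
    using c by (auto simp: bij_betw_def)
  have sub: "c ` {..<n} \<subseteq> complex_verts K"
  proof
    fix v assume "v \<in> c ` {..<n}"
    then obtain e where "e \<in> K" "v \<in> e"
      unfolding verts[symmetric] bd[symmetric] by (auto simp: boundary_def Let_def complex_edges_def)
    then show "v \<in> complex_verts K" using closed[of e "{v}"] by (simp add: complex_verts_def)
  qed
  define f where "f v = graph_dist (one_skeleton K) (c 0) v" for v
  have lip: "f w \<le> f v + 1" if "{v, w} \<in> complex_edges K" for v w
  proof -
    have "{w} \<in> K" using that closed[of "{v, w}" "{w}"] by (simp add: complex_edges_def)
    then show ?thesis using that unfolding f_def
      by (intro graph_dist_edge_le) (auto simp: one_skeleton_def complex_verts_def)
  qed
  have edge: "{c i, c (Suc i mod n)} \<in> complex_edges K" if "i < n" for i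
    using that E bd by (fastforce simp: boundary_def Let_def)
  have f0: "f (c 0) = 0"
    using sub assms(3) unfolding f_def by (intro graph_dist_self) (auto simp: one_skeleton_def)
  \<comment> \<open>Following the boundary from \<open>c 0\<close> in either direction bounds the
    level of a boundary vertex from above.\<close>
  have f_right: "f (c i) \<le> enat i" if "i < n" for i
    using that
  proof (induction i)
    case (Suc i)
    have "f (c (Suc i)) \<le> f (c i) + 1" using lip edge[of i] Suc.prems by simp
    also have "\<dots> \<le> enat i + 1" using Suc by (intro add_right_mono) simp
    finally show ?case by (simp add: one_enat_def)
  qed (simp add: f0)
  have f_left: "f (c (n - Suc j)) \<le> enat (Suc j)" if "j < n" for j
    using that
  proof (induction j)
    case 0
    have "f (c (n - 1)) \<le> f (c 0) + 1"
      using lip edge[of "n - 1"] assms(3) by (simp add: insert_commute)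
    then show ?case by (simp add: f0 one_enat_def)
  next
    case (Suc j)
    have "Suc (n - Suc (Suc j)) = n - Suc j" using Suc.prems by simp
    then have "f (c (n - Suc (Suc j))) \<le> f (c (n - Suc j)) + 1"
      using lip edge[of "n - Suc (Suc j)"] Suc.prems by (simp add: insert_commute)
    also have "\<dots> \<le> enat (Suc j) + 1" using Suc by (intro add_right_mono) simp
    finally show ?case by (simp add: one_enat_def)
  qed
  \<comment> \<open>The Lipschitz condition combined with \<open>cycle_dist_ge\<close>. A finite
    upper bound \<open>k\<close> for the distance in \<open>K\<close> allows real arithmetic in
    place of extended reals.\<close>
  have far: "\<delta> * real (min (j - i) (n - (j - i))) \<le> real k"
    if "i \<le> j" "j < n" "graph_dist (one_skeleton K) (c i) (c j) \<le> enat k" for i j k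
  proof -
    have "ereal_of_enat (enat (min (j - i) (n - (j - i)))) \<le> ereal_of_enat (graph_dist G (c i) (c j))"
      using cycle_dist_ge[OF inj E that(1,2)] by (simp only: ereal_of_enat_le_iff)
    then have "ereal \<delta> * ereal_of_enat (enat (min (j - i) (n - (j - i))))
        \<le> ereal \<delta> * ereal_of_enat (graph_dist G (c i) (c j))"
      using assms(1) by (intro ereal_mult_left_mono) auto
    also have "\<dots> \<le> ereal_of_enat (graph_dist (one_skeleton K) (c i) (c j))"
      using that verts by (intro lipschitz) auto
    also have "\<dots> \<le> ereal_of_enat (enat k)"
      using that(3) by (simp only: ereal_of_enat_le_iff)
    finally show ?thesis by simp
  qed
  define m where "m = n div 2"
  have m: "0 < m" "m < n" "real n - 1 \<le> 2 * real m" "m \<le> n - m" using assms(3) by (auto simp: m_def)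
  \<comment> \<open>Since \<open>n - 1 \<le> 2 * m\<close>, \<open>D\<close> is at most
    \<open>\<delta> * m\<close>, a lower bound for the level of \<open>c m\<close>. \<open>T\<close>
    is the largest integer strictly below \<open>D\<close>, so all levels from 1 to \<open>T\<close>
    lie strictly between those of \<open>c 0\<close> and \<open>c m\<close>.\<close>
  define D where "D = \<delta> * (real n - 1) / 2"
  define T where "T = nat (\<lceil>D\<rceil> - 1)"
  have D: "0 < D" "real T < D" "D \<le> real T + 1"
    using assms(1,3) by (auto simp: D_def T_def) linarith+
  define L where "L r = {v \<in> complex_verts K. f v = enat r}" for r
  have level: "2 * \<delta> * min (real r) (D - real r) - 1 \<le> real (card (L r - c ` {..<n}))"
    if r: "r \<in> {1..T}" for r
  proof -
    define H where "H = \<lparr>graph_verts = L r, graph_edges = complex_edges K\<rparr>"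
    have "real r < D" using r D by auto
    also have "D \<le> \<delta> * real m" using m(3) assms(1) by (simp add: D_def)
    finally have "\<not> f (c m) \<le> enat r"
      using far[of 0 m r] m by (auto simp: f_def min_def)
    then have rm: "enat r < f (c m)" by simp
    have r0: "f (c 0) < enat r" using r by (simp add: f0 zero_enat_def)
    obtain i0 j0 p where ij0: "0 < i0" "i0 < m" "m < j0" "j0 < n" "graph_walk H (c i0) p (c j0)"
      using level_set_joins_arcs[OF K finK E[folded bd] inj sub m(2) lip r0 rm]
      unfolding H_def L_def by blast
    \<comment> \<open>\<open>X\<close> and \<open>Y\<close> together are all boundary vertices, so
      the inner vertices counted by \<open>graph_dist_le_card_interior\<close> lie off the
      boundary.\<close>
    define X where "X = c ` {..m}"
    define Y where "Y = c ` {m<..<n}"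
    have "X \<inter> Y = {}" using inj m unfolding X_def Y_def by (fastforce simp: inj_on_eq_iff)
    moreover have "finite (graph_verts H)" using fin by (simp add: H_def L_def)
    moreover have "c i0 \<in> X" "c j0 \<in> Y" using ij0 by (auto simp: X_def Y_def)
    ultimately obtain x y where "x \<in> X" "y \<in> Y" "x \<in> graph_verts H" "y \<in> graph_verts H"
      and dist: "graph_dist H x y \<le> enat (card (graph_verts H - (X \<union> Y)) + 1)"
      using graph_dist_le_card_interior[OF _ _ ij0(5)] by metis
    then obtain i j where i: "x = c i" "i \<le> m" "f (c i) = enat r"
      and j: "y = c j" "m < j" "j < n" "f (c j) = enat r"
      by (auto simp: X_def Y_def H_def L_def)
    have XY: "X \<union> Y = c ` {..<n}"
      unfolding X_def Y_def using m(2) by (auto simp flip: image_Un intro!: arg_cong[where f = "image c"])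
    \<comment> \<open>Both ends have distance \<open>r\<close> from \<open>c 0\<close> in
      \<open>K\<close>. This bounds their cycle distances \<open>i\<close> and \<open>n - j\<close>
      from \<open>c 0\<close> below by \<open>r\<close>, and above through
      \<open>far\<close>.\<close>
    have "r \<le> i" using f_right[of i] i m by simp
    have "r \<le> n - j" using f_left[of "n - Suc j"] j by (simp add: Suc_diff_Suc)
    have "\<delta> * real i \<le> real r"
      using far[of 0 i r] i m by (auto simp: f_def min_def split: if_splits)
    have "\<delta> * real (n - j) \<le> real r"
      using far[of 0 j r] j m by (auto simp: f_def min_def split: if_splits)
    have "graph_dist (one_skeleton K) (c i) (c j) \<le> enat (card (L r - c ` {..<n}) + 1)"
      using dist graph_dist_antimono[of H "one_skeleton K" x y]
      by (auto simp: XY i j H_def L_def one_skeleton_def)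
    from far[OF _ _ this] i j
    have *: "\<delta> * real (min (j - i) (n - (j - i))) \<le> real (card (L r - c ` {..<n})) + 1" by simp
    \<comment> \<open>Weakening \<delta> n - 2 r to the tent 2 \<delta> (D - r) makes the summand symmetric in r and D - r.\<close>
    have "2 * \<delta> * min (real r) (D - real r) \<le> \<delta> * real (min (j - i) (n - (j - i)))"
    \<comment> \<open>The arc through \<open>c m\<close> has \<open>j - i\<close> edges and is long
      because \<open>i\<close> and \<open>n - j\<close> are small; the arc through
      \<open>c 0\<close> has \<open>i + (n - j)\<close> edges, at least
      \<open>2 * r\<close>.\<close>
    proof (cases "j - i \<le> n - (j - i)")
      case True
      have "\<delta> * real n - 2 * real r \<le> \<delta> * real (j - i)"
        using \<open>\<delta> * real i \<le> real r\<close> \<open>\<delta> * real (n - j) \<le> real r\<close> i j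
        by (simp add: of_nat_diff algebra_simps)
      moreover have "\<delta> * (\<delta> * (real n - 1) - 2 * real r) \<le> \<delta> * (real n - 1) - 2 * real r"
        using \<open>real r < D\<close> assms(1,2) by (intro mult_left_le_one_le) (auto simp: D_def)
      moreover have "2 * \<delta> * min (real r) (D - real r) \<le> 2 * \<delta> * (D - real r)"
        using assms(1) by (intro mult_left_mono) auto
      moreover have "2 * \<delta> * (D - real r) = \<delta> * (\<delta> * (real n - 1) - 2 * real r)"
        by (simp add: D_def field_simps)
      moreover have "\<delta> * (real n - 1) \<le> \<delta> * real n" using assms(1) by simp
      ultimately have "2 * \<delta> * min (real r) (D - real r) \<le> \<delta> * real (j - i)" by linarith
      then show ?thesis using True by simp
    next
      case False
      have "2 * r \<le> n - (j - i)" using \<open>r \<le> i\<close> \<open>r \<le> n - j\<close> i j by simp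
      then have "\<delta> * (2 * real r) \<le> \<delta> * real (n - (j - i))"
        using assms(1) by (intro mult_left_mono) linarith+
      moreover have "2 * \<delta> * min (real r) (D - real r) \<le> 2 * \<delta> * real r"
        using assms(1) by (intro mult_left_mono) auto
      moreover have "min (j - i) (n - (j - i)) = n - (j - i)" using False by linarith
      ultimately show ?thesis by simp
    qed
    with * show ?thesis by linarith
  qed
  have "2 * \<delta> * ((D\<^sup>2 - 1) / 4) - real T
      \<le> 2 * \<delta> * (\<Sum>r=1..T. min (real r) (D - real r)) - real T"
    using sum_tent_ge[OF D] assms(1) by (intro diff_right_mono mult_left_mono) auto
  also have "\<dots> = (\<Sum>r=1..T. 2 * \<delta> * min (real r) (D - real r) - 1)"
    by (simp add: sum_subtractf sum_distrib_left)
  also have "\<dots> \<le> (\<Sum>r=1..T. real (card (L r - c ` {..<n})))"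
    using level by (rule sum_mono)
  \<comment> \<open>Distinct levels are disjoint, so no vertex is counted twice.\<close>
  also have "\<dots> = real (card (\<Union>r\<in>{1..T}. L r - c ` {..<n}))"
    using fin by (subst card_UN_disjoint) (auto simp: L_def)
  also have "\<dots> \<le> real (card (complex_verts K - c ` {..<n}))"
    using fin by (intro of_nat_mono card_mono) (auto simp: L_def)
  also have "\<dots> = real (card (complex_verts K)) - real n"
    using sub fin inj card_mono[OF fin sub]
    by (simp add: card_Diff_subset card_image of_nat_diff finite_subset)
  finally have "real (card (complex_verts K)) \<ge> \<delta> * D\<^sup>2 / 2 - \<delta> / 2 - real T + real n"
    by (simp add: field_simps)
  \<comment> \<open>From \<open>T < D\<close> and
    \<open>D + \<delta> / 2 = \<delta> * n / 2\<close>. With \<open>\<delta> \<le> 1\<close> at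
    least half of the \<open>n\<close> boundary vertices remain after paying for the loss of 1 per
    level and for \<open>\<delta> / 2\<close>.\<close>
  moreover have "real T + \<delta> / 2 \<le> \<delta> * real n / 2" using D by (simp add: D_def field_simps)
  moreover have "\<delta> * real n \<le> real n" using assms(1,2) by (intro mult_left_le_one_le) auto
  ultimately have "real (card (complex_verts K)) \<ge> \<delta> * D\<^sup>2 / 2 + 1 / 2 * (real n - 1)"
    by argo
  moreover have "\<delta> * D\<^sup>2 / 2 = \<delta> ^ 3 / 8 * (real n - 1) ^ 2"
    by (simp add: D_def power2_eq_square power3_eq_cube field_simps)
  ultimately show "real (card (complex_verts K))
      \<ge> \<delta> ^ 3 / 8 * (real n - 1) ^ 2 + 1 / 2 * (real n - 1)"
    by simp
qed

end
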